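(* Let $k\geq2$ be an integer. The map $\overline{\phi_k}:\mathbb{R}^2/G'\to D_{2k+1}^+$ is one-to-one (i.e. bijective).
   Context: $\mathbb{R}^2$ has coordinates $(p,q)$; the group $G'=\left\{\begin{pmatrix}1&n\\0&\epsilon\end{pmatrix}: n\in\mathbb{Z},\ \epsilon\in\{\pm1\}\right\}$ acts on it by $(n,\epsilon)\cdot(p,q)=(p+nq,\epsilon q)$. $\mathbb{R}^2/G'$ is the quotient of $\mathbb{R}^2$ by the closed equivalence relation identifying points of the same $G'$-orbit and identifying all points $(p,0)$, $p\in\mathbb{R}$. $D_{2k+1}=\{(x,y,z)\in\mathbb{R}^3: zx^2+y^2=z^{2k+1}\}$ and $D_{2k+1}^+=D_{2k+1}\cap\{z\geq0\}$. The map $\phi_k:\mathbb{R}^2\to\mathbb{R}^3$, $\phi_k(p,q)=\left(q^{2k}\cos\frac{2\pi p}{q},\,q^{2k+1}\sin\frac{2\pi p}{q},\,q^2\right)$ for $q\neq0$, $\phi_k(p,0)=(0,0,0)$, is constant on equivalence classes and takes values in $D_{2k+1}^+$; $\overline{\phi_k}$ is the induced map on the quotient.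
   Formalization: The target D_{2k+1}^+ is replaced by D_{2k+1}^+ without the points (x,0,0), x≠0: these satisfy the defining equation with z=0 but are never attained, since q^2=0 forces the value (0,0,0), so surjectivity onto all of D_{2k+1}^+ fails. *)

theory Defs
  imports "HOL-Analysis.Analysis"
begin

definition G' :: "(real^2^2) set" where
  "G' = {vector [vector [1, of_int n], vector [0, e]] | (n::int) (e::real). e \<in> {1, -1}}"

lemma G'_action:
  "(vector [vector [1, of_int n], vector [0, e]] :: real^2^2) *v vector [p, q]
     = vector [p + of_int n * q, e * q]"
  by (simp add: vec_eq_iff forall_2 matrix_vector_mult_def sum_2)

text \<open>Points of the same orbit are identified, and so are all points of the line \<open>q = 0\<close>;
  since this line is invariant under the group, no further points have to be identified.
  That the result is a closed equivalence relation is proved below.\<close>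

definition G'_rel :: "((real^2) \<times> (real^2)) set" where
  "G'_rel = {(v, w). (\<exists>A\<in>G'. w = A *v v) \<or> (v $ 2 = 0 \<and> w $ 2 = 0)}"

definition R2_mod_G' :: "(real^2) set set" where
  "R2_mod_G' = UNIV // G'_rel"

definition D_odd :: "nat \<Rightarrow> (real^3) set" where
  "D_odd k = {u. u $ 3 * (u $ 1)^2 + (u $ 2)^2 = (u $ 3)^(2 * k + 1)}"

definition D_odd_plus :: "nat \<Rightarrow> (real^3) set" where
  "D_odd_plus k = D_odd k \<inter> {u. u $ 3 \<ge> 0}"

definition phi :: "nat \<Rightarrow> real^2 \<Rightarrow> real^3" where
  "phi k v = (let p = v $ 1; q = v $ 2 in
     if q = 0 then 0
     else vector [q^(2 * k) * cos (2 * pi * p / q),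
                  q^(2 * k + 1) * sin (2 * pi * p / q),
                  q^2])"

text \<open>The common value of \<open>phi k\<close> on an equivalence class (see \<open>phi_respects\<close>).\<close>

definition phi_bar :: "nat \<Rightarrow> (real^2) set \<Rightarrow> real^3" where
  "phi_bar k C = the_elem (phi k ` C)"

lemma G'_rel_iff:
  "(v, w) \<in> G'_rel \<longleftrightarrow>
     (\<exists>n::int. w $ 1 = v $ 1 + of_int n * v $ 2 \<and> (w $ 2 = v $ 2 \<or> w $ 2 = - v $ 2))
     \<or> (v $ 2 = 0 \<and> w $ 2 = 0)"
proof -
  have "(\<exists>A\<in>G'. w = A *v v) \<longleftrightarrow>
    (\<exists>n::int. \<exists>e::real. e \<in> {1,-1} \<and> w = vector [vector [1, of_int n], vector [0, e]] *v v)"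
    unfolding G'_def by blast
  also have "\<dots> \<longleftrightarrow>
    (\<exists>n::int. \<exists>e::real. e \<in> {1,-1} \<and> w $ 1 = v $ 1 + of_int n * v $ 2 \<and> w $ 2 = e * v $ 2)"
    by (simp add: vec_eq_iff forall_2 matrix_vector_mult_def sum_2)
  also have "\<dots> \<longleftrightarrow>
    (\<exists>n::int. w $ 1 = v $ 1 + of_int n * v $ 2 \<and> (w $ 2 = v $ 2 \<or> w $ 2 = - v $ 2))"
    by (simp add: conj_disj_distribR ex_disj_distrib conj_disj_distribL)
  finally show ?thesis unfolding G'_rel_def by simp
qed

lemma equiv_G'_rel: "equiv UNIV G'_rel"
proof (rule equivI)
  show "G'_rel \<subseteq> UNIV \<times> UNIV" by simp
  show "refl G'_rel"
    by (rule refl_onI) (auto simp: G'_rel_iff intro: exI[of _ "0::int"])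
  show "sym G'_rel"
  proof (rule symI)
    fix v w assume "(v, w) \<in> G'_rel"
    then consider (a) n :: int where "w $ 1 = v $ 1 + of_int n * v $ 2" "w $ 2 = v $ 2"
      | (b) n :: int where "w $ 1 = v $ 1 + of_int n * v $ 2" "w $ 2 = - v $ 2"
      | (c) "v $ 2 = 0" "w $ 2 = 0"
      by (auto simp: G'_rel_iff)
    then show "(w, v) \<in> G'_rel"
    proof cases
      case a then show ?thesis unfolding G'_rel_iff by (intro disjI1 exI[of _ "-n"]) auto
    next
      case b then show ?thesis unfolding G'_rel_iff by (intro disjI1 exI[of _ n]) auto
    next
      case c then show ?thesis by (auto simp: G'_rel_iff)
    qed
  qed
  show "trans G'_rel"
  proof (rule transI)
    fix u v w assume uv: "(u, v) \<in> G'_rel" and vw: "(v, w) \<in> G'_rel"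
    show "(u, w) \<in> G'_rel"
    proof (cases "u $ 2 = 0")
      case True
      then have "v $ 2 = 0" using uv by (auto simp: G'_rel_iff)
      then have "w $ 2 = 0" using vw by (auto simp: G'_rel_iff)
      with True show ?thesis by (auto simp: G'_rel_iff)
    next
      case False
      from uv False obtain n :: int where
        n: "v $ 1 = u $ 1 + of_int n * u $ 2" "v $ 2 = u $ 2 \<or> v $ 2 = - u $ 2"
        by (auto simp: G'_rel_iff)
      from n(2) False have "v $ 2 \<noteq> 0" by auto
      with vw obtain m :: int where
        m: "w $ 1 = v $ 1 + of_int m * v $ 2" "w $ 2 = v $ 2 \<or> w $ 2 = - v $ 2"
        by (auto simp: G'_rel_iff)
      from n(2) show ?thesis
      proof
        assume "v $ 2 = u $ 2"
        with n m show ?thesis unfolding G'_rel_iff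
          by (intro disjI1 exI[of _ "n + m"]) (auto simp: algebra_simps)
      next
        assume "v $ 2 = - u $ 2"
        with n m show ?thesis unfolding G'_rel_iff
          by (intro disjI1 exI[of _ "n - m"]) (auto simp: algebra_simps)
      qed
    qed
  qed
qed

lemma G'_rel_iff_Ints:
  "(v, w) \<in> G'_rel \<longleftrightarrow> \<bar>v $ 2\<bar> = \<bar>w $ 2\<bar> \<and> (v $ 2 \<noteq> 0 \<longrightarrow> (w $ 1 - v $ 1) / v $ 2 \<in> \<int>)"
proof (cases "v $ 2 = 0")
  case True
  then show ?thesis by (auto simp: G'_rel_iff)
next
  case False
  have "(\<exists>n::int. w $ 1 = v $ 1 + of_int n * v $ 2) \<longleftrightarrow> (w $ 1 - v $ 1) / v $ 2 \<in> \<int>"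
    using False by (auto simp: Ints_def field_simps)
  with False show ?thesis unfolding G'_rel_iff by (auto simp: abs_eq_iff)
qed

lemma closed_G'_rel: "closed G'_rel"
  unfolding closed_sequential_limits
proof (intro allI impI, elim conjE)
  fix x :: "nat \<Rightarrow> (real^2) \<times> (real^2)" and l
  assume x: "\<forall>i. x i \<in> G'_rel" and lim: "x \<longlonglongrightarrow> l"
  obtain v w where l: "l = (v, w)" by (cases l)
  have fl: "(\<lambda>i. fst (x i) $ j) \<longlonglongrightarrow> v $ j" and sl: "(\<lambda>i. snd (x i) $ j) \<longlonglongrightarrow> w $ j" for j
    using tendsto_fst[OF lim] tendsto_snd[OF lim] l by (auto intro: tendsto_vec_nth)
  have xi: "\<bar>fst (x i) $ 2\<bar> = \<bar>snd (x i) $ 2\<bar>"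
    "fst (x i) $ 2 \<noteq> 0 \<Longrightarrow> (snd (x i) $ 1 - fst (x i) $ 1) / fst (x i) $ 2 \<in> \<int>" for i
    using x[rule_format, of i] G'_rel_iff_Ints[of "fst (x i)" "snd (x i)"] by auto
  have "\<bar>v $ 2\<bar> = \<bar>w $ 2\<bar>"
    using LIMSEQ_unique[OF tendsto_rabs[OF fl[of 2]]] tendsto_rabs[OF sl[of 2]] xi(1) by simp
  moreover have "(w $ 1 - v $ 1) / v $ 2 \<in> \<int>" if v2: "v $ 2 \<noteq> 0"
  proof -
    have ev: "eventually (\<lambda>i. fst (x i) $ 2 \<noteq> 0) sequentially"
      using tendsto_imp_eventually_ne[OF fl[of 2] v2] .
    have "(\<lambda>i. (snd (x i) $ 1 - fst (x i) $ 1) / fst (x i) $ 2) \<longlonglongrightarrow> (w $ 1 - v $ 1) / v $ 2"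
      by (intro tendsto_intros fl sl v2)
    moreover have "eventually (\<lambda>i. (snd (x i) $ 1 - fst (x i) $ 1) / fst (x i) $ 2 \<in> \<int>) sequentially"
      using ev by eventually_elim (use xi(2) in blast)
    ultimately show ?thesis
      by (rule Lim_in_closed_set[OF closed_Ints, rotated 2]) simp
  qed
  ultimately show "l \<in> G'_rel" unfolding l G'_rel_iff_Ints by simp
qed

lemma phi_respects:
  assumes "(v, w) \<in> G'_rel" shows "phi k v = phi k w"
proof (cases "v $ 2 = 0")
  case True
  with assms show ?thesis by (auto simp: G'_rel_iff phi_def)
next
  case False
  with assms obtain n :: int where
    n: "w $ 1 = v $ 1 + of_int n * v $ 2" "w $ 2 = v $ 2 \<or> w $ 2 = - v $ 2"
    by (auto simp: G'_rel_iff)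
  have arg: "2 * pi * (v $ 1 + of_int n * v $ 2) / v $ 2 = 2 * pi * v $ 1 / v $ 2 + 2 * pi * of_int n"
    using False by (simp add: field_simps)
  have "cos (2 * pi * w $ 1 / v $ 2) = cos (2 * pi * v $ 1 / v $ 2)"
       "sin (2 * pi * w $ 1 / v $ 2) = sin (2 * pi * v $ 1 / v $ 2)"
    unfolding n(1) arg by (simp_all add: cos_add sin_add cos_int_2pin sin_int_2pin)
  with n(2) False show ?thesis by (auto simp: phi_def Let_def)
qed

lemma phi_bar_class: "phi_bar k (G'_rel `` {v}) = phi k v"
proof -
  have "v \<in> G'_rel `` {v}"
    using equiv_G'_rel by (simp add: equiv_def refl_on_def)
  moreover have "phi k w = phi k v" if "w \<in> G'_rel `` {v}" for w
    using that phi_respects[of v w k] by simp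
  ultimately have "phi k ` (G'_rel `` {v}) = {phi k v}" by blast
  then show ?thesis by (simp add: phi_bar_def)
qed

lemma phi_in_D_odd_plus: "phi k v \<in> D_odd_plus k"
proof (cases "v $ 2 = 0")
  case True
  then show ?thesis by (simp add: phi_def D_odd_plus_def D_odd_def)
next
  case False
  define q and t where "q = v $ 2" and "t = 2 * pi * v $ 1 / v $ 2"
  have "q^2 * (q^(2*k) * cos t)^2 + (q^(2*k+1) * sin t)^2
      = (q^(2*k+1))^2 * ((sin t)^2 + (cos t)^2)"
    unfolding distrib_left by (simp add: power_mult_distrib power_add power2_eq_square)
  also have "\<dots> = (q^2)^(2*k+1)" by (simp only: power_mult [symmetric] mult.commute) simp
  finally show ?thesis using False
    by (simp add: phi_def D_odd_plus_def D_odd_def q_def t_def Let_def)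
qed

text \<open>The set \<open>D_odd_plus k\<close> contains the whole line \<open>y = z = 0\<close>, of which \<open>phi k\<close> only attains
  the origin: \<open>z = q\<^sup>2 = 0\<close> forces \<open>q = 0\<close>. So \<open>phi_bar k\<close> is not onto \<open>D_odd_plus k\<close>, and
  the surjectivity half of the bijectivity claim is only possible once the other points of that
  line are removed from the target.\<close>

definition x_axis_punctured :: "(real^3) set" where
  "x_axis_punctured = {vector [x, 0, 0] | x. x \<noteq> 0}"

lemma x_axis_punctured_subset: "x_axis_punctured \<subseteq> D_odd_plus k"
  by (auto simp: x_axis_punctured_def D_odd_plus_def D_odd_def)

lemma phi_notin_x_axis_punctured: "phi k v \<notin> x_axis_punctured"
  by (auto simp: x_axis_punctured_def phi_def Let_def vec_eq_iff forall_3 split: if_splits)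

lemma not_onto_D_odd_plus: "\<not> bij_betw (phi_bar k) R2_mod_G' (D_odd_plus k)"
proof
  assume "bij_betw (phi_bar k) R2_mod_G' (D_odd_plus k)"
  then have img: "phi_bar k ` R2_mod_G' = D_odd_plus k"
    by (rule bij_betw_imp_surj_on)
  have ax: "(vector [1, 0, 0] :: real^3) \<in> x_axis_punctured"
    unfolding x_axis_punctured_def by (rule CollectI, rule exI[of _ 1]) simp
  then have "vector [1, 0, 0] \<in> phi_bar k ` R2_mod_G'"
    unfolding img by (rule subsetD[OF x_axis_punctured_subset])
  then obtain C where C: "C \<in> R2_mod_G'" "vector [1, 0, 0] = phi_bar k C"
    by (rule imageE)
  from C(1) obtain v where v: "C = G'_rel `` {v}"
    unfolding R2_mod_G'_def by (rule quotientE)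
  have "vector [1, 0, 0] = phi k v"
    using C(2) unfolding v phi_bar_class .
  with ax phi_notin_x_axis_punctured[of k v] show False by simp
qed

end

theory Submission
  imports Defs
begin

text \<open>Slice the target by height \<open>z\<close>. For \<open>z > 0\<close> the slice is an
  ellipse: with \<open>q\<^sup>2 = z\<close>, dividing the equation by
  \<open>z ^ (2 * k + 1)\<close> gives the unit circle in \<open>x / q ^ (2 * k)\<close> and
  \<open>y / q ^ (2 * k + 1)\<close>, and \<open>phi k\<close> runs through it with angle
  \<open>2 * pi * p / q\<close>. The height fixes \<open>q\<close> up to sign, the point fixes the
  angle modulo \<open>2 * pi\<close>, hence \<open>p\<close> modulo integer multiples of
  \<open>q\<close>: exactly one orbit (\<open>phi_eq_imp_G'_rel\<close>), and every angle occurs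
  (\<open>in_range_phi\<close>). At height 0 the slice is the whole x-axis, while the collapsed line
  \<open>q = 0\<close> gives only the origin, so the other axis points are left out.\<close>

lemma phi_eq_imp_G'_rel:
  assumes "phi k v = phi k w"
  shows "(v, w) \<in> G'_rel"
proof -
  have third: "phi k u $ 3 = (u $ 2)\<^sup>2" for u
    by (simp add: phi_def Let_def)
  from assms have sq: "(v $ 2)\<^sup>2 = (w $ 2)\<^sup>2"
    using third by metis
  show ?thesis
  proof (cases "v $ 2 = 0")
    case True
    with sq show ?thesis by (simp add: G'_rel_iff)
  next
    case False
    define q s t where "q = v $ 2" and "s = 2 * pi * v $ 1 / q" and "t = 2 * pi * w $ 1 / q"
    have q0: "q \<noteq> 0" using False by (simp add: q_def)
    have w2: "w $ 2 = q \<or> w $ 2 = - q"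
      using sq by (auto simp: q_def power2_eq_iff)
    have phiv: "phi k v = vector [q ^ (2 * k) * cos s, q ^ (2 * k + 1) * sin s, q\<^sup>2]"
      using q0 by (simp add: phi_def Let_def q_def s_def)
    \<comment> \<open>This also covers second coordinate \<open>-q\<close>: cosine and the even
      power ignore the sign, and the signs from sine and the odd power cancel.\<close>
    have phiw: "phi k w = vector [q ^ (2 * k) * cos t, q ^ (2 * k + 1) * sin t, q\<^sup>2]"
      using q0 w2 by (auto simp: phi_def Let_def t_def)
    have "cos t = cos s" "sin t = sin s"
      using assms q0 unfolding phiv phiw by (simp_all add: vec_eq_iff forall_3)
    then obtain n :: int where "t = s + 2 * pi * of_int n"
      using sin_cos_eq_iff[of t s] by auto
    then have "2 * pi * w $ 1 = 2 * pi * (v $ 1 + of_int n * q)"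
      using q0 by (simp add: s_def t_def field_simps)
    then have "w $ 1 = v $ 1 + of_int n * q" by simp
    with w2 show ?thesis by (auto simp: G'_rel_iff q_def)
  qed
qed

lemma in_range_phi:
  assumes "u \<in> D_odd_plus k - x_axis_punctured"
  shows "u \<in> range (phi k)"
proof -
  define x y z where "x = u $ 1" and "y = u $ 2" and "z = u $ 3"
  have u: "u = vector [x, y, z]"
    by (simp add: vec_eq_iff forall_3 x_def y_def z_def)
  have eq: "z * x\<^sup>2 + y\<^sup>2 = z ^ (2 * k + 1)" and z: "z \<ge> 0"
    using assms by (auto simp: D_odd_plus_def D_odd_def x_def y_def z_def)
  show ?thesis
  proof (cases "z = 0")
    case True
    with eq have y: "y = 0" by simp
    \<comment> \<open>At height 0 the equation leaves \<open>x\<close> free; only the removal of the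
      punctured axis pins it down.\<close>
    have "x = 0"
    proof (rule ccontr)
      assume "x \<noteq> 0"
      then have "u \<in> x_axis_punctured"
        unfolding x_axis_punctured_def u True y by blast
      with assms show False by simp
    qed
    then have "u = phi k 0"
      by (simp add: u True y phi_def vec_eq_iff forall_3)
    then show ?thesis by simp
  next
    case False
    define q where "q = sqrt z"
    have q: "q \<noteq> 0" "q\<^sup>2 = z" using z False by (auto simp: q_def)
    \<comment> \<open>With \<open>z = q\<^sup>2\<close> every term is a square, so division by the
      right-hand side yields a point of the unit circle.\<close>
    have "(q * x)\<^sup>2 + y\<^sup>2 = (q ^ (2 * k + 1))\<^sup>2"
      using eq unfolding q(2)[symmetric] power_mult_distrib power_mult[symmetric]
      by (simp add: mult.commute)
    moreover have "q * x / q ^ (2 * k + 1) = x / q ^ (2 * k)"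
      using q(1) by simp
    ultimately have "(x / q ^ (2 * k))\<^sup>2 + (y / q ^ (2 * k + 1))\<^sup>2 = 1"
      using q(1) by (metis add_divide_distrib div_self power_divide power_not_zero)
    then obtain t where t: "x / q ^ (2 * k) = cos t" "y / q ^ (2 * k + 1) = sin t"
      by (rule sincos_total_2pi) blast
    have "x = q ^ (2 * k) * cos t" "y = q ^ (2 * k + 1) * sin t"
      using q(1) by (simp_all flip: t)
    \<comment> \<open>The first coordinate solves \<open>2 * pi * p / q = t\<close> for
      \<open>p\<close>.\<close>
    then have "u = phi k (vector [q * t / (2 * pi), q])"
      using q by (simp add: u phi_def Let_def)
    then show ?thesis by simp
  qed
qed

theorem lemma4p8:
  fixes k :: nat
  assumes "k \<ge> 2"
  shows "bij_betw (phi_bar k) R2_mod_G' (D_odd_plus k - x_axis_punctured)"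
proof -
  have classes: "R2_mod_G' = range (\<lambda>v. G'_rel `` {v})"
    by (auto simp: R2_mod_G'_def quotient_def)
  have "inj_on (phi_bar k) R2_mod_G'"
    unfolding classes
    by (auto intro!: inj_onI equiv_class_eq[OF equiv_G'_rel] phi_eq_imp_G'_rel[of k]
        simp: phi_bar_class)
  moreover have "phi_bar k ` R2_mod_G' = range (phi k)"
    unfolding classes image_image phi_bar_class ..
  moreover have "range (phi k) = D_odd_plus k - x_axis_punctured"
    using phi_in_D_odd_plus phi_notin_x_axis_punctured in_range_phi by blast
  ultimately show ?thesis by (simp add: bij_betw_def)
qed

end
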